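(* Let $a<b$, and let $f:[a,b]\to\mathbb{R}$ be differentiable with $f(a)>0$ and $|f'(x)-f'(y)|\le L|x-y|$ for all $x,y\in[a,b]$, where $0<L<\infty$. Suppose $f$ has a root in $[a,b]$ and let $x^*=\min\{x\in[a,b]:f(x)=0\}$. Let $\{x^n\}$ be the infinite sequence of trial points generated by algorithm A2 (described in the context) with parameters $\xi>0$, $r>1$ and stopping tolerance $\sigma=0$. During the $n$th iteration let $t=t(n)$ be the index of an interval $[x_{t-1},x_t]$ containing $x^*$, let $L_t$ be the local Lipschitz constant of $f'$ over $[x_{t-1},x_t]$, and let $m_t$ be the estimate of $L_t$ computed by A2. If there exists an iteration number $n^*$ such that for all $n>n^*$ the inequality $m_t\ge L_t$ holds, then $x^*$ is the unique limit point (accumulation point) of the sequence $\{x^n\}$.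
   Context: Algorithm A2. The parameters are $\xi>0$ and $r>1$. The search starts from finitely many (at least two) initial trial points that include $a$ and $b$. A trial at a point $x$ means evaluating $f(x)$ and $f'(x)$. Suppose trials have been made at $x^1,\dots,x^n$, $n\ge 2$. The next trial point $x^{n+1}$ is chosen as follows. Step 1 (ordering). Arrange the distinct trial points in increasing order $a=x_1<x_2<\dots<x_N=b$ (subscripts give the position in this order, which depends on $n$; $N=n$ if no point is repeated). Put $z_i=f(x_i)$, $z_i'=f'(x_i)$ and $k=\min(\{N\}\cup\{i: f(x_i)<0,\ 1<i\le N\})$. Only the intervals $[x_{i-1},x_i]$, $1<i\le k$, are considered. Step 2 (estimates of local Lipschitz constants). For $1<j\le k$ let $$v_j=\frac{|2(z_{j-1}-z_j)+(z_j'+z_{j-1}')(x_j-x_{j-1})|+d_j}{(x_j-x_{j-1})^2},$$ $$d_j=\sqrt{[2(z_{j-1}-z_j)+(z_j'+z_{j-1}')(x_j-x_{j-1})]^2+(z_j'-z_{j-1}')^2(x_j-x_{j-1})^2}.$$ For $1<i\le k$ let $\lambda_i=\max\{v_j:1<j\le k,\ i-1\le j\le i+1\}$, $m=\max\{v_j:1<j\le k\}$, $X^{\max}=\max\{x_j-x_{j-1}:2\le j\le k\}$, $\gamma_i=m(x_i-x_{i-1})/X^{\max}$, and $$m_i=r\cdot\max\{\lambda_i,\gamma_i,\xi\}.$$ Auxiliary functions. For $1<i\le k$ let $$q_i=\frac{z_{i-1}-z_i+z_i'x_i-z_{i-1}'x_{i-1}+0.5m_i(x_i^2-x_{i-1}^2)}{m_i(x_i-x_{i-1})+z_i'-z_{i-1}'},$$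 $$y_i=\frac{x_i-x_{i-1}}{4}+\frac{z_i'-z_{i-1}'}{4m_i}+q_i,\qquad y_i'=-\frac{x_i-x_{i-1}}{4}-\frac{z_i'-z_{i-1}'}{4m_i}+q_i,$$ $$b_i=z_i'-2m_iy_i+m_ix_i,\qquad c_i=z_i-z_i'x_i-0.5m_ix_i^2+m_iy_i^2,$$ $$\phi_i(x)=\begin{cases} z_{i-1}+z_{i-1}'(x-x_{i-1})-0.5m_i(x-x_{i-1})^2, & x\in[x_{i-1},y_i'],\\ 0.5m_ix^2+b_ix+c_i, & x\in(y_i',y_i],\\ z_i-z_i'(x_i-x)-0.5m_i(x_i-x)^2, & x\in(y_i,x_i],\end{cases}$$ and $\widehat x_i=2y_i-z_i'm_i^{-1}-x_i$ (the zero of the derivative of the middle quadratic). Step 3 (characteristics). For $i=2,3,\dots$ in increasing order, while $i\le k$: if $\phi_i'(y_i')\phi_i'(y_i)\ge 0$, let $h_i$ be whichever of $x_{i-1},x_i$ gives the smaller value of $f$, put $R_i=\phi_i(h_i)$, and say $i\in Y$ if $h_i=x_i$ and $i\in Y'$ otherwise; if $\phi_i'(y_i')\phi_i'(y_i)<0$, let $h_i$ be the point among $x_{i-1},\widehat x_i,x_i$ with the smallest value of $\phi_i$, put $R_i=\phi_i(h_i)$, and say $i\in I$. If $R_i\le 0$, go immediately to Step 5 with this $i$; otherwise pass to $i+1$. If all $R_i>0$, $1<i\le k$, go to Step 4. Step 4. Choose $i$ with $R_i=\min\{R_j:1<j\le k\}$ (no tie-breaking rule is specified) and set $x^{n+1}=y_i'$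 if $i\in Y'$, $x^{n+1}=\widehat x_i$ if $i\in I$, $x^{n+1}=y_i$ if $i\in Y$. Go to Step 6. Step 5 ($R_i\le 0$). Consider the three candidate points (A) $x_{i-1}+\frac1{m_i}\left(z_{i-1}'+\sqrt{(z_{i-1}')^2+2m_iz_{i-1}}\right)$, (B) $x_i+\frac1{m_i}\left(z_i'+\sqrt{(z_i')^2+2m_iz_i}\right)$, (C) $\frac{-b_i-\sqrt{b_i^2-2m_ic_i}}{m_i}$. If $\phi_i(y_i')\le 0$, take $x^{n+1}$ to be (A). If $\phi_i(y_i')>0$ and $\phi_i'(y_i')\phi_i'(y_i)<0$, take (B) when $\phi_i(\widehat x_i)>0$ and (C) when $\phi_i(\widehat x_i)\le 0$. If $\phi_i(y_i')>0$ and $\phi_i'(y_i')\phi_i'(y_i)\ge 0$, take (B) when $\phi_i(y_i)>0$ and (C) when $\phi_i(y_i)\le 0$. Go to Step 6. Step 6 (stopping rule). Stop if $|x_i-x_{i-1}|\le\sigma$ for the selected $i$. Otherwise make a trial at $x^{n+1}$, replace $n$ by $n+1$ and return to Step 1. With $\sigma=0$ an infinite sequence $\{x^n\}$ is generated. The local Lipschitz constant of $f'$ over an interval $[u,v]$ is the smallest constant $\Lambda$ with $|f'(x)-f'(y)|\le \Lambda|x-y|$ for all $x,y\in[u,v]$. *)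

theory Defs
  imports "HOL-Analysis.Analysis"
begin

text \<open>
  One iteration of the search: \<open>X 1, \<dots>, X n\<close> are the trials made so far, in the order in
  which they were made (\<open>X 0\<close> is never used). All indices are 1-based.
\<close>

locale A2 =
  fixes f f' :: "real \<Rightarrow> real"
    and \<xi> r :: real
    and X :: "nat \<Rightarrow> real"
    and n :: nat
begin

definition N :: nat where
  "N = card (X ` {1..n})"

definition pt :: "nat \<Rightarrow> real" where
  "pt i = sorted_list_of_set (X ` {1..n}) ! (i - 1)"

definition z :: "nat \<Rightarrow> real" where
  "z i = f (pt i)"

definition z' :: "nat \<Rightarrow> real" where
  "z' i = f' (pt i)"

definition k :: nat where
  "k = Min ({N} \<union> {i. 1 < i \<and> i \<le> N \<and> f (pt i) < 0})"

definition len :: "nat \<Rightarrow> real" where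
  "len i = pt i - pt (i - 1)"

definition d :: "nat \<Rightarrow> real" where
  "d j = sqrt ((2 * (z (j - 1) - z j) + (z' j + z' (j - 1)) * len j)\<^sup>2
               + (z' j - z' (j - 1))\<^sup>2 * (len j)\<^sup>2)"

definition v :: "nat \<Rightarrow> real" where
  "v j = (\<bar>2 * (z (j - 1) - z j) + (z' j + z' (j - 1)) * len j\<bar> + d j) / (len j)\<^sup>2"

definition lam :: "nat \<Rightarrow> real" where
  "lam i = Max (v ` {j. 1 < j \<and> j \<le> k \<and> i - 1 \<le> j \<and> j \<le> i + 1})"

definition v_max :: real where
  "v_max = Max (v ` {j. 1 < j \<and> j \<le> k})"

definition X_max :: real where
  "X_max = Max (len ` {2..k})"

definition gam :: "nat \<Rightarrow> real" where
  "gam i = v_max * len i / X_max"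

definition m :: "nat \<Rightarrow> real" where
  "m i = r * Max {lam i, gam i, \<xi>}"

definition q :: "nat \<Rightarrow> real" where
  "q i = (z (i - 1) - z i + z' i * pt i - z' (i - 1) * pt (i - 1)
            + 1 / 2 * m i * ((pt i)\<^sup>2 - (pt (i - 1))\<^sup>2))
         / (m i * len i + z' i - z' (i - 1))"

definition y :: "nat \<Rightarrow> real" where
  "y i = len i / 4 + (z' i - z' (i - 1)) / (4 * m i) + q i"

definition y' :: "nat \<Rightarrow> real" where
  "y' i = - (len i / 4) - (z' i - z' (i - 1)) / (4 * m i) + q i"

definition b :: "nat \<Rightarrow> real" where
  "b i = z' i - 2 * m i * y i + m i * pt i"

definition c :: "nat \<Rightarrow> real" where
  "c i = z i - z' i * pt i - 1 / 2 * m i * (pt i)\<^sup>2 + m i * (y i)\<^sup>2"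

text \<open>
  The auxiliary function on \<open>[x\<^sub>i\<^sub>-\<^sub>1, x\<^sub>i]\<close>. Its outer pieces are continued by the same quadratics
  beyond the interval, so that the two-sided derivative below also makes sense at an end point.
\<close>

definition \<phi> :: "nat \<Rightarrow> real \<Rightarrow> real" where
  "\<phi> i x =
     (if x \<le> y' i then z (i - 1) + z' (i - 1) * (x - pt (i - 1)) - 1 / 2 * m i * (x - pt (i - 1))\<^sup>2
      else if x \<le> y i then 1 / 2 * m i * x\<^sup>2 + b i * x + c i
      else z i - z' i * (pt i - x) - 1 / 2 * m i * (pt i - x)\<^sup>2)"

definition x_hat :: "nat \<Rightarrow> real" where
  "x_hat i = 2 * y i - z' i / m i - pt i"

text \<open>Whether \<open>i\<close> is in the class \<open>I\<close>.\<close>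

definition in_I :: "nat \<Rightarrow> bool" where
  "in_I i \<longleftrightarrow> deriv (\<phi> i) (y' i) * deriv (\<phi> i) (y i) < 0"

text \<open>
  \<open>valid_h h\<close>: the points \<open>h i\<close> are admissible choices of \<open>h\<^sub>i\<close>. This is a predicate on \<open>h\<close>
  because ties may be broken either way.
\<close>

definition valid_h :: "(nat \<Rightarrow> real) \<Rightarrow> bool" where
  "valid_h h \<longleftrightarrow>
     (\<forall>i\<in>{2..k}. if in_I i then is_arg_min (\<phi> i) (\<lambda>x. x \<in> {pt (i - 1), x_hat i, pt i}) (h i)
                 else is_arg_min f (\<lambda>x. x \<in> {pt (i - 1), pt i}) (h i))"

definition R :: "(nat \<Rightarrow> real) \<Rightarrow> nat \<Rightarrow> real" where
  "R h i = \<phi> i (h i)"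

definition step4_point :: "(nat \<Rightarrow> real) \<Rightarrow> nat \<Rightarrow> real" where
  "step4_point h i = (if in_I i then x_hat i else if h i = pt i then y i else y' i)"

definition cand_A :: "nat \<Rightarrow> real" where
  "cand_A i = pt (i - 1) + 1 / m i * (z' (i - 1) + sqrt ((z' (i - 1))\<^sup>2 + 2 * m i * z (i - 1)))"

definition cand_B :: "nat \<Rightarrow> real" where
  "cand_B i = pt i + 1 / m i * (z' i + sqrt ((z' i)\<^sup>2 + 2 * m i * z i))"

definition cand_C :: "nat \<Rightarrow> real" where
  "cand_C i = (- b i - sqrt ((b i)\<^sup>2 - 2 * m i * c i)) / m i"

definition step5_point :: "nat \<Rightarrow> real" where
  "step5_point i =
     (if \<phi> i (y' i) \<le> 0 then cand_A i
      else if in_I i then (if \<phi> i (x_hat i) > 0 then cand_B i else cand_C i)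
      else (if \<phi> i (y i) > 0 then cand_B i else cand_C i))"

text \<open>
  \<open>selects i p\<close>: the iteration may select the interval with index \<open>i\<close> and propose \<open>p\<close> as
  the next trial point.
\<close>

definition selects :: "nat \<Rightarrow> real \<Rightarrow> bool" where
  "selects i p \<longleftrightarrow> i \<in> {2..k} \<and>
     (\<exists>h. valid_h h \<and>
        (R h i \<le> 0 \<and> (\<forall>j\<in>{2..<i}. R h j > 0) \<and> p = step5_point i
         \<or> (\<forall>j\<in>{2..k}. R h j > 0) \<and> is_arg_min (R h) (\<lambda>j. j \<in> {2..k}) i \<and> p = step4_point h i))"

end

text \<open>
  \<open>X\<close> is an infinite sequence of trials generated with stopping tolerance \<open>\<sigma>\<close>, whose first
  \<open>n0\<close> members are the initial trials.
\<close>

definition A2_sequence ::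
  "real \<Rightarrow> real \<Rightarrow> (real \<Rightarrow> real) \<Rightarrow> (real \<Rightarrow> real) \<Rightarrow> real \<Rightarrow> real \<Rightarrow> real \<Rightarrow> nat \<Rightarrow> (nat \<Rightarrow> real) \<Rightarrow> bool"
where
  "A2_sequence a b f f' \<xi> r \<sigma> n0 X \<longleftrightarrow>
     2 \<le> n0 \<and> X ` {1..n0} \<subseteq> {a..b} \<and> a \<in> X ` {1..n0} \<and> b \<in> X ` {1..n0} \<and>
     (\<forall>n\<ge>n0. \<exists>i. A2.selects f f' \<xi> r X n i (X (Suc n)) \<and>
                 \<not> \<bar>A2.pt X n i - A2.pt X n (i - 1)\<bar> \<le> \<sigma>)"

definition local_lipschitz_const :: "(real \<Rightarrow> real) \<Rightarrow> real \<Rightarrow> real \<Rightarrow> real" where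
  "local_lipschitz_const g u w = (LEAST C. C-lipschitz_on {u..w} g)"

definition seq_limit_points :: "(nat \<Rightarrow> real) \<Rightarrow> real set" where
  "seq_limit_points X = {l. \<exists>s :: nat \<Rightarrow> nat. strict_mono s \<and> (X \<circ> s) \<longlonglongrightarrow> l}"

end

theory Submission
  imports Defs
begin

text \<open>
  On each interval \<open>[x\<^sub>i\<^sub>-\<^sub>1, x\<^sub>i]\<close> the function \<open>\<phi>\<^sub>i\<close> consists of
  two concave parabolas with curvature \<open>- m\<^sub>i\<close> attached to the ends and a convex one with curvature
  \<open>m\<^sub>i\<close> that touches both. Since \<open>m\<^sub>i\<close> exceeds \<open>v\<^sub>i\<close>, the least Lipschitz constant compatible with
  the four values of \<open>f\<close> and \<open>f'\<close> at the ends, the points of contact lie strictly inside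
  the interval in the right order (\<open>knots_ordered\<close>). Therefore \<open>R\<^sub>i\<close> is the minimum of \<open>\<phi>\<^sub>i\<close>
  (\<open>R_le_phi\<close>), and when \<open>R\<^sub>i \<le> 0\<close> the point proposed by Step 5 is the \<^emph>\<open>first zero\<close> of \<open>\<phi>\<^sub>i\<close>
  (\<open>first_zero_step5_point\<close>), provided that \<open>f\<close> is positive at \<open>x\<^sub>i\<^sub>-\<^sub>1\<close>. It is, because the scan
  from the left has found only positive characteristics so far (\<open>left_value_pos\<close>).

  If \<open>m\<^sub>t\<close> is at least the local Lipschitz constant, then \<open>\<phi>\<^sub>t\<close> is a minorant of \<open>f\<close> (\<open>phi_le_f\<close>),
  so \<open>\<phi>\<^sub>t\<close> is not positive at the root. From that iteration on, the selected \<open>i\<close> is at most \<open>t\<close> and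
  the new trial is a first zero of \<open>\<phi>\<^sub>i\<close>; if \<open>i = t\<close>, it comes no later than the root, and if \<open>i < t\<close>,
  it is in an interval to the left of the root. Either way all later trials lie to the left of
  \<open>x\<^sup>*\<close> or coincide with it (\<open>selects_first_zero\<close>).

  Trials cannot accumulate at a point to the left of \<open>x\<^sup>*\<close>. On \<open>[a, w]\<close> with \<open>w < x\<^sup>*\<close> the function
  is bounded below by a positive number, whereas \<open>\<phi>\<^sub>i\<close> vanishes at the new trial. The numbers \<open>m\<^sub>i\<close>
  are bounded (\<open>v_le_if_lipschitz\<close>, \<open>m_le\<close>), so \<open>\<phi>\<^sub>i\<close> needs a certain distance to fall from such
  values to zero (\<open>zero_far_from_ends\<close>). Hence new trials in a smaller interval \<open>[a, w']\<close> with \<open>w' < w\<close>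
  keep a fixed distance from both neighbours, and so from all previous trials. As the trials stay in \<open>[a, b]\<close>, a limit point
  exists, and \<open>x\<^sup>*\<close> is the only possibility.
\<close>

(* Keeps the index i - 1 of a left end in the form in which the definitions write it. *)
declare One_nat_def [simp del]

section \<open>Calculus and quadratic functions\<close>

lemma tangent_le_if_mono_deriv:
  fixes g g' :: "real \<Rightarrow> real"
  assumes deriv: "\<And>x. x \<in> {u..w} \<Longrightarrow> (g has_real_derivative g' x) (at x within {u..w})"
    and mono: "mono_on {u..w} g'"
    and s: "s \<in> {u..w}" and t: "t \<in> {u..w}"
  shows "g s + g' s * (t - s) \<le> g t"
proof -
  have slope: "\<exists>c\<in>{p..q}. g q - g p = g' c * (q - p)" if "p \<le> q" "p \<in> {u..w}" "q \<in> {u..w}" for p q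
  proof -
    have "(g has_derivative (\<lambda>h. g' x * h)) (at x within {p..q})" if "p \<le> x" "x \<le> q" for x
      using has_derivative_subset[of g "(*) (g' x)" x "{u..w}" "{p..q}"] deriv[of x]
        that \<open>p \<in> {u..w}\<close> \<open>q \<in> {u..w}\<close>
      by (auto simp: has_field_derivative_def)
    then show ?thesis
      using mvt_very_simple[OF \<open>p \<le> q\<close>, of g "\<lambda>x h. g' x * h"] by blast
  qed
  show ?thesis
  proof (cases "s \<le> t")
    case True
    obtain c where "c \<in> {s..t}" and c: "g t - g s = g' c * (t - s)"
      using slope[OF True s t] by blast
    then have "g' s \<le> g' c"
      using mono s t by (auto simp: mono_on_def)
    then have "g' s * (t - s) \<le> g' c * (t - s)"
      using True by (intro mult_right_mono) auto
    then show ?thesis using c by simp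
  next
    case False
    obtain c where "c \<in> {t..s}" and c: "g s - g t = g' c * (s - t)"
      using slope[OF _ t s] False by force
    then have "g' c \<le> g' s"
      using mono s t by (auto simp: mono_on_def)
    then have "g' c * (s - t) \<le> g' s * (s - t)"
      using False by (intro mult_right_mono) auto
    then show ?thesis using c by (simp add: algebra_simps)
  qed
qed

text \<open>
  If \<open>f'\<close> is \<open>M\<close>-Lipschitz, then \<open>M x\<^sup>2 / 2 + f x\<close> and \<open>M x\<^sup>2 / 2 - f x\<close> have nondecreasing
  derivatives and lie above their tangents.
\<close>

lemma lipschitz_deriv_taylor:
  fixes f f' :: "real \<Rightarrow> real"
  assumes deriv: "\<And>x. x \<in> {u..w} \<Longrightarrow> (f has_real_derivative f' x) (at x within {u..w})"
    and lip: "M-lipschitz_on {u..w} f'"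
    and s: "s \<in> {u..w}" and t: "t \<in> {u..w}"
  shows "\<bar>f t - (f s + f' s * (t - s))\<bar> \<le> M / 2 * (t - s)\<^sup>2"
proof -
  have slope: "\<bar>f' x - f' y\<bar> \<le> M * (y - x)" if "x \<in> {u..w}" "y \<in> {u..w}" "x \<le> y" for x y
    using lipschitz_onD[OF lip that(1,2)] that(3) by (simp add: dist_real_def)
  have "M / 2 * s\<^sup>2 + f s + (M * s + f' s) * (t - s) \<le> M / 2 * t\<^sup>2 + f t"
  proof (rule tangent_le_if_mono_deriv[OF _ _ s t])
    show "mono_on {u..w} (\<lambda>x. M * x + f' x)"
      using slope by (intro mono_onI) (force simp: abs_le_iff algebra_simps)
  qed (auto intro!: derivative_eq_intros deriv)
  moreover have "M / 2 * s\<^sup>2 - f s + (M * s - f' s) * (t - s) \<le> M / 2 * t\<^sup>2 - f t"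
  proof (rule tangent_le_if_mono_deriv[OF _ _ s t])
    show "mono_on {u..w} (\<lambda>x. M * x - f' x)"
      using slope by (intro mono_onI) (force simp: abs_le_iff algebra_simps)
  qed (auto intro!: derivative_eq_intros deriv)
  ultimately show ?thesis
    by (simp add: abs_le_iff power2_eq_square algebra_simps)
qed

lemma has_real_derivative_max_0_square:
  fixes c x :: real
  shows "((\<lambda>x. (max 0 (x - c))\<^sup>2) has_real_derivative 2 * max 0 (x - c)) (at x)"
proof (cases x c rule: linorder_cases)
  case less
  have "((\<lambda>x. 0) has_real_derivative 2 * max 0 (x - c)) (at x)"
    using less by (simp add: max_def)
  then show ?thesis
    by (rule DERIV_cong_ev[THEN iffD1, rotated -1])
      (use less in \<open>auto intro!: eventually_mono[OF order_tendstoD(2)[OF tendsto_ident_at less]] simp: eventually_nhds_conv_at max_def\<close>)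
next
  case greater
  have "((\<lambda>x. (x - c)\<^sup>2) has_real_derivative 2 * max 0 (x - c)) (at x)"
    using greater by (auto intro!: derivative_eq_intros simp: max_def)
  then show ?thesis
    by (rule DERIV_cong_ev[THEN iffD1, rotated -1])
      (use greater in \<open>auto intro!: eventually_mono[OF order_tendstoD(1)[OF tendsto_ident_at greater]] simp: eventually_nhds_conv_at max_def\<close>)
next
  case equal
  have "(\<lambda>y. ((max 0 (y - c))\<^sup>2 - (max 0 (x - c))\<^sup>2) / (y - x)) \<midarrow>x\<rightarrow> 0"
  proof (rule Lim_null_comparison)
    show "\<forall>\<^sub>F y in at x. norm (((max 0 (y - c))\<^sup>2 - (max 0 (x - c))\<^sup>2) / (y - x)) \<le> \<bar>y - x\<bar>"
      using equal by (auto simp: max_def power2_eq_square)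
    show "(\<lambda>y. \<bar>y - x\<bar>) \<midarrow>x\<rightarrow> 0"
      by (auto intro!: tendsto_eq_intros)
  qed
  then show ?thesis
    using equal by (simp add: has_field_derivative_iff)
qed

text \<open>
  \<open>\<alpha> + \<beta> x - M x\<^sup>2 / 2\<close> exceeds the chord by a nonnegative multiple of
  \<open>(x - p) (s - x)\<close>.
\<close>

lemma concave_parabola_above_ends:
  fixes M :: real
  assumes "0 \<le> M" "p \<le> x" "x \<le> s" and P: "\<And>x. P x = \<alpha> + \<beta> * x - M / 2 * x\<^sup>2"
  shows "min (P p) (P s) \<le> P x"
proof (cases "p = s")
  case False
  then have "p < s" using assms by simp
  have "(s - p) * P x = (s - x) * P p + (x - p) * P s + M / 2 * ((s - p) * ((x - p) * (s - x)))"
    by (simp add: P power2_eq_square field_simps)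
  also have "\<dots> \<ge> (s - x) * min (P p) (P s) + (x - p) * min (P p) (P s)"
  proof -
    have "0 \<le> M / 2 * ((s - p) * ((x - p) * (s - x)))"
      using assms by simp
    moreover have "(s - x) * min (P p) (P s) \<le> (s - x) * P p"
      "(x - p) * min (P p) (P s) \<le> (x - p) * P s"
      using assms by (auto intro!: mult_left_mono)
    ultimately show ?thesis by linarith
  qed
  also have "(s - x) * min (P p) (P s) + (x - p) * min (P p) (P s) = (s - p) * min (P p) (P s)"
    by (simp add: algebra_simps)
  finally show ?thesis
    using \<open>p < s\<close> by simp
qed (use assms in auto)

text \<open>
  The formulas for the three trial points of Step 5 are the quadratic formula in disguise; in factored
  form the signs between and beyond the roots can be read off.
\<close>

lemma concave_quadratic_factor:
  fixes M \<beta> \<gamma> s :: real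
  assumes "0 < M" "0 \<le> \<beta>\<^sup>2 + 2 * M * \<gamma>"
  shows "\<gamma> + \<beta> * s - M / 2 * s\<^sup>2 =
    M / 2 * ((s - (\<beta> - sqrt (\<beta>\<^sup>2 + 2 * M * \<gamma>)) / M) * ((\<beta> + sqrt (\<beta>\<^sup>2 + 2 * M * \<gamma>)) / M - s))"
proof -
  define D where "D = sqrt (\<beta>\<^sup>2 + 2 * M * \<gamma>)"
  have "D * D = \<beta>\<^sup>2 + 2 * M * \<gamma>" using assms(2) by (simp add: D_def)
  then have \<gamma>: "\<gamma> = (D * D - \<beta> * \<beta>) / (2 * M)"
    using assms(1) by (simp add: power2_eq_square)
  show ?thesis
    unfolding D_def[symmetric] unfolding \<gamma>
    using assms(1) by (simp add: power2_eq_square field_simps)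
qed

section \<open>The auxiliary function on one interval\<close>

text \<open>
  The geometry of \<open>\<phi>\<^sub>i\<close> rests on the strict inequality \<open>v\<^sub>i < m\<^sub>i\<close>, which \<open>r > 1\<close> and \<open>\<xi> > 0\<close>
  provide on every interval that is scanned: it makes the three pieces proper and join smoothly.
\<close>

locale A2_interval = A2 +
  fixes i :: nat
  assumes pt_less: "pt (i - 1) < pt i"
    and v_less_m: "v i < m i"
begin

abbreviation "x0 \<equiv> pt (i - 1)"
abbreviation "x1 \<equiv> pt i"
abbreviation "z0 \<equiv> z (i - 1)"
abbreviation "z1 \<equiv> z i"
abbreviation "g0 \<equiv> z' (i - 1)"
abbreviation "g1 \<equiv> z' i"
abbreviation "M \<equiv> m i"

definition left_parabola :: "real \<Rightarrow> real" where
  "left_parabola x = z0 + g0 * (x - x0) - 1 / 2 * M * (x - x0)\<^sup>2"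

definition right_parabola :: "real \<Rightarrow> real" where
  "right_parabola x = z1 - g1 * (x1 - x) - 1 / 2 * M * (x1 - x)\<^sup>2"

definition mid_parabola :: "real \<Rightarrow> real" where
  "mid_parabola x = 1 / 2 * M * x\<^sup>2 + b i * x + c i"

text \<open>
  The number \<open>v\<^sub>i\<close> is the larger root of \<open>h\<^sup>2 v\<^sup>2 - 2 \<bar>A\<bar> v - G\<^sup>2\<close>, with \<open>h\<close> the length of the
  interval, \<open>G\<close> the increment of the derivative and \<open>A\<close> the error of the trapezoidal rule (doubled).
  So \<open>v\<^sub>i < m\<^sub>i\<close> makes this quadratic positive at \<open>m\<^sub>i\<close>, and it also makes \<open>\<bar>G\<bar> < m\<^sub>i h\<close>.
\<close>

lemma discriminants_pos:
  defines "A \<equiv> 2 * (z0 - z1) + (g1 + g0) * len i"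
  shows M_pos: "0 < M"
    and slope_gap: "0 < M * len i + g1 - g0"
    and "(g1 - g0)\<^sup>2 < (M * len i)\<^sup>2 + 2 * M * A"
    and "(g1 - g0)\<^sup>2 < (M * len i)\<^sup>2 - 2 * M * A"
proof -
  have len: "0 < len i" using pt_less by (simp add: len_def)
  have d: "d i = sqrt (A\<^sup>2 + ((g1 - g0) * len i)\<^sup>2)"
    by (simp add: d_def A_def power_mult_distrib)
  have vd: "v i * (len i)\<^sup>2 = \<bar>A\<bar> + d i"
    using len by (simp add: v_def A_def)
  have d_ge: "\<bar>A\<bar> \<le> d i" "\<bar>(g1 - g0) * len i\<bar> \<le> d i" "0 \<le> d i"
    by (auto simp: d real_le_rsqrt)
  have "0 \<le> v i" using d_ge by (simp add: v_def)
  with v_less_m show M: "0 < M" by simp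
  have *: "\<bar>A\<bar> + d i < M * (len i)\<^sup>2"
    using mult_strict_right_mono[OF v_less_m, of "(len i)\<^sup>2"] len vd by simp
  moreover have "\<bar>g1 - g0\<bar> * len i \<le> d i"
    using d_ge(2) len by (simp add: abs_mult)
  moreover have "M * (len i)\<^sup>2 = (M * len i) * len i"
    by (simp add: power2_eq_square)
  ultimately have "\<bar>g1 - g0\<bar> * len i < (M * len i) * len i"
    using abs_ge_zero[of A] by linarith
  then have "\<bar>g1 - g0\<bar> < M * len i"
    using len by (simp only: mult_less_cancel_right_pos)
  then show "0 < M * len i + g1 - g0" by linarith
  from * have "(d i)\<^sup>2 < (M * (len i)\<^sup>2 - \<bar>A\<bar>)\<^sup>2"
    using d_ge by (intro power_strict_mono) auto
  also have "(d i)\<^sup>2 = A\<^sup>2 + (g1 - g0)\<^sup>2 * (len i)\<^sup>2"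
    by (simp add: d power_mult_distrib)
  finally have "(g1 - g0)\<^sup>2 * (len i)\<^sup>2 < ((M * len i)\<^sup>2 - 2 * M * \<bar>A\<bar>) * (len i)\<^sup>2"
    by (simp add: power2_eq_square algebra_simps)
  then have "(g1 - g0)\<^sup>2 < (M * len i)\<^sup>2 - 2 * M * \<bar>A\<bar>"
    using len by (simp add: mult_less_cancel_right_disj)
  moreover have "2 * M * A \<le> 2 * M * \<bar>A\<bar>" "2 * M * - A \<le> 2 * M * \<bar>A\<bar>"
    using M by (intro mult_left_mono; simp)+
  moreover have "2 * M * - A = - (2 * M * A)" by simp
  ultimately have "(g1 - g0)\<^sup>2 < (M * len i)\<^sup>2 + 2 * M * A \<and> (g1 - g0)\<^sup>2 < (M * len i)\<^sup>2 - 2 * M * A"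
    by linarith
  then show "(g1 - g0)\<^sup>2 < (M * len i)\<^sup>2 + 2 * M * A"
    and "(g1 - g0)\<^sup>2 < (M * len i)\<^sup>2 - 2 * M * A" by blast+
qed

lemma y_q: "4 * M * y i = 4 * M * q i + (M * len i + g1 - g0)"
  and y'_q: "4 * M * y' i = 4 * M * q i - (M * len i + g1 - g0)"
  using M_pos by (simp_all add: y_def y'_def field_simps)

lemma q_mult: "2 * q i * (M * len i + g1 - g0) =
    2 * (z0 - z1 + g1 * x1 - g0 * x0) + M * (x1\<^sup>2 - x0\<^sup>2)"
  using slope_gap by (simp add: q_def)

text \<open>
  Write \<open>D = m\<^sub>i h + G\<close>, the positive denominator of \<open>q\<^sub>i\<close>. Then \<open>y\<^sub>i - y\<^sub>i' = D / (2 m\<^sub>i)\<close>, while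
  \<open>4 m\<^sub>i D (y\<^sub>i' - x\<^sub>i\<^sub>-\<^sub>1)\<close> and \<open>4 m\<^sub>i D (x\<^sub>i - y\<^sub>i)\<close> turn out to be the two expressions
  \<open>m\<^sub>i\<^sup>2 h\<^sup>2 \<plusminus> 2 m\<^sub>i A - G\<^sup>2\<close> shown to be positive above.
\<close>

lemma knots_ordered:
  shows x0_less_y': "x0 < y' i" and y'_less_y: "y' i < y i" and y_less_x1: "y i < x1"
proof -
  define D where "D = M * len i + g1 - g0"
  have D: "0 < D" using slope_gap by (simp add: D_def)
  then have MD: "0 < 4 * M * D" using M_pos by simp
  have x1: "x1 = x0 + len i" by (simp add: len_def)
  have q2: "2 * q i * D = 2 * (z0 - z1 + g1 * x1 - g0 * x0) + M * (x1\<^sup>2 - x0\<^sup>2)"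
    using q_mult by (simp add: D_def)
  have "4 * M * y' i < 4 * M * y i"
    using D y_q y'_q unfolding D_def by linarith
  then show "y' i < y i" using M_pos by simp
  have "4 * M * D * (y' i - x0) = D * (4 * M * y' i) - 4 * M * D * x0"
    by (simp add: algebra_simps)
  also have "\<dots> = 2 * M * (2 * q i * D) - D\<^sup>2 - 4 * M * D * x0"
    unfolding y'_q D_def[symmetric] by (simp add: algebra_simps power2_eq_square)
  also have "\<dots> = (M * len i)\<^sup>2 + 2 * M * (2 * (z0 - z1) + (g1 + g0) * len i) - (g1 - g0)\<^sup>2"
    unfolding q2 unfolding D_def x1 by (simp add: algebra_simps power2_eq_square)
  also have "\<dots> > 0" using discriminants_pos by simp
  finally have "0 < y' i - x0"
    using MD by (rule zero_less_mult_pos)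
  then show "x0 < y' i" by simp
  have "4 * M * D * (x1 - y i) = 4 * M * D * x1 - D * (4 * M * y i)"
    by (simp add: algebra_simps)
  also have "\<dots> = 4 * M * D * x1 - 2 * M * (2 * q i * D) - D\<^sup>2"
    unfolding y_q D_def[symmetric] by (simp add: algebra_simps power2_eq_square)
  also have "\<dots> = (M * len i)\<^sup>2 - 2 * M * (2 * (z0 - z1) + (g1 + g0) * len i) - (g1 - g0)\<^sup>2"
    unfolding q2 unfolding D_def x1 by (simp add: algebra_simps power2_eq_square)
  also have "\<dots> > 0" using discriminants_pos by simp
  finally have "0 < x1 - y i"
    using MD by (rule zero_less_mult_pos)
  then show "y i < x1" by simp
qed

text \<open>
  The middle parabola touches both outer ones. At \<open>y\<^sub>i\<close> this is how \<open>b\<^sub>i\<close> and \<open>c\<^sub>i\<close> were chosen.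
  At \<open>y\<^sub>i'\<close> it is the choice of \<open>q\<^sub>i\<close>: the difference of the outer parabolas is affine
  with slope \<open>D = m\<^sub>i h + G\<close> and vanishes exactly at \<open>q\<^sub>i\<close>, and so is
  \<open>m\<^sub>i (x - y\<^sub>i')\<^sup>2 - m\<^sub>i (x - y\<^sub>i)\<^sup>2\<close>, because the knots lie symmetrically about \<open>q\<^sub>i\<close>.
\<close>

lemma mid_eq_right: "mid_parabola x = right_parabola x + M * (x - y i)\<^sup>2"
  by (simp add: mid_parabola_def right_parabola_def b_def c_def power2_eq_square algebra_simps)

lemma mid_eq_left: "mid_parabola x = left_parabola x + M * (x - y' i)\<^sup>2"
proof -
  define D where "D = M * len i + g1 - g0"
  have gap: "2 * M * (y i - y' i) = D" and sum: "y i + y' i = 2 * q i"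
    using y_q y'_q by (simp add: D_def right_diff_distrib) (simp add: y_def y'_def)
  have "right_parabola x - left_parabola x = D * x - (2 * q i * D) / 2"
    unfolding D_def q_mult
    by (simp add: right_parabola_def left_parabola_def len_def power2_eq_square field_simps)
  also have "\<dots> = M * (x - y' i)\<^sup>2 - M * (x - y i)\<^sup>2"
    unfolding gap[symmetric] sum[symmetric] by (simp add: power2_eq_square algebra_simps diff_divide_distrib)
  finally show ?thesis
    using mid_eq_right by simp
qed

lemma phi_left: "x \<le> y' i \<Longrightarrow> \<phi> i x = left_parabola x"
  by (simp add: \<phi>_def left_parabola_def)

lemma phi_mid: "y' i \<le> x \<Longrightarrow> x \<le> y i \<Longrightarrow> \<phi> i x = mid_parabola x"
  using mid_eq_left[of x] by (cases "x = y' i") (auto simp: \<phi>_def mid_parabola_def left_parabola_def)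

lemma phi_right: "y i \<le> x \<Longrightarrow> \<phi> i x = right_parabola x"
  using mid_eq_right[of x] y'_less_y
  by (cases "x = y i") (auto simp: \<phi>_def mid_parabola_def right_parabola_def)

lemma phi_ends: "\<phi> i x0 = z0" "\<phi> i x1 = z1"
  using knots_ordered by (simp_all add: phi_left phi_right left_parabola_def right_parabola_def)

lemma max_0: "p \<le> 0 \<Longrightarrow> max 0 p = 0" "0 \<le> p \<Longrightarrow> max 0 p = (p :: real)"
  by simp_all

text \<open>
  A formula without case distinction: crossing a knot adds or removes a squared positive part. It gives
  both the differentiability of \<open>\<phi>\<^sub>i\<close> at the knots and the comparison with the left parabola.
\<close>

lemma phi_eq_left: "\<phi> i x = left_parabola x + M * (max 0 (x - y' i))\<^sup>2 - M * (max 0 (x - y i))\<^sup>2"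
proof -
  consider "x \<le> y' i" | "y' i \<le> x" "x \<le> y i" | "y i \<le> x" by linarith
  then show ?thesis
    using y'_less_y mid_eq_left[of x] mid_eq_right[of x]
    by cases (simp_all add: phi_left phi_mid phi_right max_0)
qed

lemma left_parabola_le_phi: "left_parabola x \<le> \<phi> i x"
proof -
  have "(max 0 (x - y i))\<^sup>2 \<le> (max 0 (x - y' i))\<^sup>2"
    using y'_less_y by (intro power_mono) auto
  then show ?thesis
    using M_pos by (simp add: phi_eq_left)
qed

lemma right_parabola_le_phi: "right_parabola x \<le> \<phi> i x"
proof -
  have "(max 0 (y' i - x))\<^sup>2 \<le> (max 0 (y i - x))\<^sup>2"
    using y'_less_y by (intro power_mono) auto
  moreover have "right_parabola x = \<phi> i x + M * (max 0 (y' i - x))\<^sup>2 - M * (max 0 (y i - x))\<^sup>2"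
  proof -
    consider "x \<le> y' i" | "y' i \<le> x" "x \<le> y i" | "y i \<le> x" by linarith
    then show ?thesis
      using y'_less_y mid_eq_left[of x] mid_eq_right[of x]
      by cases (simp_all add: phi_left phi_mid phi_right max_0 power2_commute)
  qed
  ultimately show ?thesis
    using M_pos by simp
qed

lemma x_hat_eq: "M * x_hat i = - b i"
  using M_pos by (simp add: x_hat_def b_def field_simps)

lemma mid_vertex: "mid_parabola x = mid_parabola (x_hat i) + M / 2 * (x - x_hat i)\<^sup>2"
proof -
  have b: "b i = - (M * x_hat i)" by (simp add: x_hat_eq)
  show ?thesis
    unfolding mid_parabola_def b by (simp add: power2_eq_square algebra_simps)
qed

lemma deriv_phi_knots:
  "deriv (\<phi> i) (y' i) = M * (y' i - x_hat i)"
  "deriv (\<phi> i) (y i) = M * (y i - x_hat i)"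
proof -
  have "(\<phi> i has_real_derivative g0 - M * (x - x0) + 2 * M * max 0 (x - y' i) - 2 * M * max 0 (x - y i)) (at x)" for x
  proof -
    have "(left_parabola has_real_derivative g0 - M * (x - x0)) (at x)"
      unfolding left_parabola_def[abs_def]
      by (auto intro!: derivative_eq_intros simp: algebra_simps diff_divide_distrib)
    note DERIV_diff[OF DERIV_add[OF this DERIV_cmult[OF has_real_derivative_max_0_square, of M "y' i"]]
        DERIV_cmult[OF has_real_derivative_max_0_square, of M "y i"]]
    then show ?thesis
      by (simp add: phi_eq_left[abs_def] mult.left_commute mult.assoc)
  qed
  then have D: "deriv (\<phi> i) x = g0 - M * (x - x0) + 2 * M * max 0 (x - y' i) - 2 * M * max 0 (x - y i)" for x
    by (rule DERIV_imp_deriv)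
  have "M * x_hat i = 2 * M * y i - g1 - M * x1"
    using M_pos by (simp add: x_hat_def right_diff_distrib)
  moreover have "2 * M * (y i - y' i) = M * (x1 - x0) + g1 - g0"
    using y_q y'_q by (simp add: len_def right_diff_distrib)
  ultimately show "deriv (\<phi> i) (y' i) = M * (y' i - x_hat i)"
    "deriv (\<phi> i) (y i) = M * (y i - x_hat i)"
    using y'_less_y by (simp_all add: D algebra_simps)
qed

text \<open>
  The class \<open>I\<close> consists of the intervals on which the vertex of the middle parabola is really a
  point of the middle piece.
\<close>

lemma in_I_iff: "in_I i \<longleftrightarrow> y' i < x_hat i \<and> x_hat i < y i"
proof -
  have "in_I i \<longleftrightarrow> (y' i - x_hat i) * (y i - x_hat i) < 0"
    using M_pos by (simp add: in_I_def deriv_phi_knots mult_less_0_iff zero_less_mult_iff)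
  then show ?thesis
    using y'_less_y by (auto simp: mult_less_0_iff)
qed


lemma phi_left_ge:
  assumes "x0 \<le> x" "x \<le> y' i"
  shows "min z0 (\<phi> i (y' i)) \<le> \<phi> i x"
proof -
  have "left_parabola t = (z0 - g0 * x0 - M / 2 * x0\<^sup>2) + (g0 + M * x0) * t - M / 2 * t\<^sup>2" for t
    by (simp add: left_parabola_def power2_eq_square field_simps)
  from concave_parabola_above_ends[OF _ assms this] show ?thesis
    using M_pos assms phi_left[of x0] by (simp add: phi_left phi_ends)
qed

lemma phi_right_ge:
  assumes "y i \<le> x" "x \<le> x1"
  shows "min (\<phi> i (y i)) z1 \<le> \<phi> i x"
proof -
  have "right_parabola t = (z1 - g1 * x1 - M / 2 * x1\<^sup>2) + (g1 + M * x1) * t - M / 2 * t\<^sup>2" for t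
    by (simp add: right_parabola_def power2_eq_square field_simps)
  from concave_parabola_above_ends[OF _ assms this] show ?thesis
    using M_pos assms phi_right[of x1] by (simp add: phi_right phi_ends)
qed

lemma phi_mid_ge:
  assumes "y' i \<le> x" "x \<le> y i"
  shows "in_I i \<Longrightarrow> \<phi> i (x_hat i) \<le> \<phi> i x"
    and "\<not> in_I i \<Longrightarrow> min (\<phi> i (y' i)) (\<phi> i (y i)) \<le> \<phi> i x"
proof -
  assume "in_I i"
  then show "\<phi> i (x_hat i) \<le> \<phi> i x"
    using assms M_pos by (simp add: in_I_iff phi_mid mid_vertex[of x])
next
  assume "\<not> in_I i"
  then consider "x_hat i \<le> y' i" | "y i \<le> x_hat i"
    by (auto simp: in_I_iff)
  then show "min (\<phi> i (y' i)) (\<phi> i (y i)) \<le> \<phi> i x"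
  proof cases
    case 1
    then have "(y' i - x_hat i)\<^sup>2 \<le> (x - x_hat i)\<^sup>2"
      using assms by (intro power_mono) auto
    then have "\<phi> i (y' i) \<le> \<phi> i x"
      using assms y'_less_y M_pos by (simp add: phi_mid mid_vertex[of x] mid_vertex[of "y' i"])
    then show ?thesis by simp
  next
    case 2
    then have "(x_hat i - y i)\<^sup>2 \<le> (x_hat i - x)\<^sup>2"
      using assms by (intro power_mono) auto
    then have "\<phi> i (y i) \<le> \<phi> i x"
      using assms y'_less_y M_pos
      by (simp add: phi_mid mid_vertex[of x] mid_vertex[of "y i"] power2_commute)
    then show ?thesis by simp
  qed
qed

text \<open>
  Outside class \<open>I\<close> the middle piece is monotone. If it increases, then so does the concave left piece,
  because its smallest slope is the common slope at \<open>y\<^sub>i'\<close>; hence the values at the knots are at least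
  \<open>z\<^sub>i\<^sub>-\<^sub>1\<close>. The other case is symmetric.
\<close>

lemma phi_knots_ge:
  assumes "\<not> in_I i"
  shows "min z0 z1 \<le> \<phi> i (y' i)" "min z0 z1 \<le> \<phi> i (y i)"
proof -
  from assms consider "x_hat i \<le> y' i" | "y i \<le> x_hat i"
    by (auto simp: in_I_iff)
  then have "min z0 z1 \<le> \<phi> i (y' i) \<and> min z0 z1 \<le> \<phi> i (y i)"
  proof cases
    case 1
    have "z0 = mid_parabola (x_hat i) + M / 2 * (x0 - x_hat i)\<^sup>2 - M * (x0 - y' i)\<^sup>2"
      using mid_eq_left[of x0] mid_vertex[of x0] x0_less_y' by (simp add: phi_left flip: phi_ends)
    also have "\<dots> = \<phi> i (y' i) - M * ((y' i - x_hat i) * (y' i - x0) + (y' i - x0)\<^sup>2 / 2)"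
      using y'_less_y by (simp add: phi_mid mid_vertex[of "y' i"] power2_eq_square field_simps)
    also have "\<dots> \<le> \<phi> i (y' i)"
      using 1 M_pos x0_less_y' by simp
    moreover have "(y' i - x_hat i)\<^sup>2 \<le> (y i - x_hat i)\<^sup>2"
      using 1 y'_less_y by (intro power_mono) auto
    then have "\<phi> i (y' i) \<le> \<phi> i (y i)"
      using y'_less_y M_pos by (simp add: phi_mid mid_vertex[of "y i"] mid_vertex[of "y' i"])
    ultimately show ?thesis by linarith
  next
    case 2
    have "z1 = mid_parabola (x_hat i) + M / 2 * (x1 - x_hat i)\<^sup>2 - M * (x1 - y i)\<^sup>2"
      using mid_eq_right[of x1] mid_vertex[of x1] y_less_x1 by (simp add: phi_right flip: phi_ends)
    also have "\<dots> = \<phi> i (y i) - M * ((x_hat i - y i) * (x1 - y i) + (x1 - y i)\<^sup>2 / 2)"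
      using y'_less_y by (simp add: phi_mid mid_vertex[of "y i"] power2_eq_square field_simps)
    also have "\<dots> \<le> \<phi> i (y i)"
      using 2 M_pos y_less_x1 by simp
    moreover have "(x_hat i - y i)\<^sup>2 \<le> (x_hat i - y' i)\<^sup>2"
      using 2 y'_less_y by (intro power_mono) auto
    then have "\<phi> i (y i) \<le> \<phi> i (y' i)"
      using y'_less_y M_pos
      by (simp add: phi_mid mid_vertex[of "y i"] mid_vertex[of "y' i"] power2_commute)
    ultimately show ?thesis by linarith
  qed
  then show "min z0 z1 \<le> \<phi> i (y' i)" "min z0 z1 \<le> \<phi> i (y i)" by auto
qed

text \<open>
  The characteristic is the minimum of \<open>\<phi>\<^sub>i\<close>: the concave outer pieces take their minima at their ends,
  and the middle piece takes its own at its vertex or, if it is monotone, at a knot.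
\<close>

lemma R_le_phi:
  assumes h: "valid_h h" and i: "i \<in> {2..k}" and x: "x \<in> {x0..x1}"
  shows "R h i \<le> \<phi> i x"
proof (cases "in_I i")
  case True
  then have "is_arg_min (\<phi> i) (\<lambda>x. x \<in> {x0, x_hat i, x1}) (h i)"
    using h i unfolding valid_h_def by metis
  then have "\<phi> i (h i) \<le> z0" "\<phi> i (h i) \<le> z1" "\<phi> i (h i) \<le> \<phi> i (x_hat i)"
    by (auto simp: is_arg_min_linorder phi_ends)
  moreover have "\<phi> i (x_hat i) \<le> \<phi> i (y' i)" "\<phi> i (x_hat i) \<le> \<phi> i (y i)"
    using phi_mid_ge(1) True y'_less_y by simp_all
  ultimately show ?thesis
    using phi_left_ge[of x] phi_right_ge[of x] phi_mid_ge(1)[of x] True x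
    unfolding R_def by (cases "x \<le> y' i"; cases "x \<le> y i") auto
next
  case False
  then have "is_arg_min f (\<lambda>x. x \<in> {x0, x1}) (h i)"
    using h i unfolding valid_h_def by metis
  then have "\<phi> i (h i) \<le> min z0 z1"
    by (auto simp: is_arg_min_linorder phi_ends z_def)
  then show ?thesis
    using phi_left_ge[of x] phi_right_ge[of x] phi_mid_ge(2)[of x] phi_knots_ge False x
    unfolding R_def by (cases "x \<le> y' i"; cases "x \<le> y i") auto
qed


section \<open>The trial point as a zero of the auxiliary function\<close>

definition first_zero :: "real \<Rightarrow> bool" where
  "first_zero p \<longleftrightarrow> x0 < p \<and> p \<le> x1 \<and> \<phi> i p = 0 \<and> (\<forall>x. x0 \<le> x \<longrightarrow> x < p \<longrightarrow> 0 < \<phi> i x)"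

text \<open>
  The left parabola is positive at \<open>x\<^sub>i\<^sub>-\<^sub>1\<close>, so it has one root on either side; the candidate (A) is the
  right one, and it is met no later than at \<open>y\<^sub>i'\<close> if \<open>\<phi>\<^sub>i\<close> is not positive there.
\<close>

lemma first_zero_cand_A:
  assumes z0: "0 < z0" and y': "\<phi> i (y' i) \<le> 0"
  shows "first_zero (cand_A i)"
proof -
  define D where "D = sqrt (g0\<^sup>2 + 2 * M * z0)"
  have "sqrt (g0\<^sup>2) < D"
    unfolding D_def using z0 M_pos by (intro real_sqrt_less_mono) simp
  then have D: "\<bar>g0\<bar> < D" by simp
  have p: "cand_A i = x0 + (g0 + D) / M"
    by (simp add: cand_A_def D_def)
  have P: "left_parabola x = M / 2 * ((x - x0 - (g0 - D) / M) * (cand_A i - x))" for x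
    unfolding left_parabola_def p D_def
    using concave_quadratic_factor[of M g0 z0 "x - x0"] M_pos z0
    by (simp add: algebra_simps)
  have neg: "(g0 - D) / M < 0" and pos: "0 < (g0 + D) / M"
    using D M_pos by (auto simp: divide_neg_pos)
  have le: "cand_A i \<le> y' i"
  proof (rule ccontr)
    assume "\<not> ?thesis"
    then have "0 < left_parabola (y' i)"
      unfolding P using neg x0_less_y' M_pos by (intro mult_pos_pos) auto
    then show False using y' by (simp add: phi_left)
  qed
  moreover have "0 < \<phi> i x" if "x0 \<le> x" "x < cand_A i" for x
  proof -
    have "0 < left_parabola x"
      unfolding P using neg that M_pos by (intro mult_pos_pos) auto
    then show ?thesis using le that by (simp add: phi_left)
  qed
  moreover have "\<phi> i (cand_A i) = 0"
    using le P[of "cand_A i"] by (simp add: phi_left)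
  ultimately show ?thesis
    using pos p knots_ordered by (auto simp: first_zero_def)
qed

text \<open>
  If \<open>\<phi>\<^sub>i\<close> is positive up to \<open>y\<^sub>i\<close> but \<open>z\<^sub>i \<le> 0\<close>, then \<open>y\<^sub>i\<close> lies strictly between the roots of the concave
  right parabola and \<open>x\<^sub>i\<close> does not, so its larger root, which is (B), is in \<open>(y\<^sub>i, x\<^sub>i]\<close>.
\<close>

lemma first_zero_cand_B:
  assumes left: "\<And>x. x0 \<le> x \<Longrightarrow> x \<le> y i \<Longrightarrow> 0 < \<phi> i x" and z1: "z1 \<le> 0"
  shows "first_zero (cand_B i)"
proof -
  define D where "D = sqrt (g1\<^sup>2 + 2 * M * z1)"
  have y: "0 < right_parabola (y i)"
    using left[of "y i"] knots_ordered by (simp add: phi_right)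
  have "g1\<^sup>2 + 2 * M * z1 = (g1 + M * (x1 - y i))\<^sup>2 + 2 * M * right_parabola (y i)"
    by (simp add: right_parabola_def power2_eq_square field_simps)
  then have disc: "0 \<le> g1\<^sup>2 + 2 * M * z1"
    using y M_pos by simp
  have p: "cand_B i = x1 - (- g1 - D) / M"
    using M_pos by (simp add: cand_B_def D_def field_simps)
  have P: "right_parabola x = M / 2 * ((cand_B i - x) * ((D - g1) / M - (x1 - x)))" for x
    unfolding right_parabola_def p D_def
    using concave_quadratic_factor[of M "- g1" z1 "x1 - x"] M_pos disc
    by (simp add: algebra_simps)
  have D: "0 \<le> D" using disc by (simp add: D_def)
  then have order: "(- g1 - D) / M \<le> (D - g1) / M"
    using M_pos by (intro divide_right_mono) auto
  have "0 < (cand_B i - y i) * ((D - g1) / M - (x1 - y i))"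
    using y M_pos unfolding P by (simp add: zero_less_mult_iff)
  then have yB: "y i < cand_B i" and big: "x1 - y i < (D - g1) / M"
    using order by (auto simp: p zero_less_mult_iff)
  have le: "cand_B i \<le> x1"
  proof (rule ccontr)
    assume "\<not> ?thesis"
    then have "0 < right_parabola x1"
      unfolding P using big y_less_x1 M_pos by (intro mult_pos_pos) auto
    then show False using z1 by (simp add: right_parabola_def)
  qed
  moreover have "\<phi> i (cand_B i) = 0"
    using yB P[of "cand_B i"] by (simp add: phi_right)
  moreover have "0 < \<phi> i x" if "x0 \<le> x" "x < cand_B i" for x
  proof (cases "x \<le> y i")
    case False
    then have "0 < right_parabola x"
      unfolding P using big that M_pos by (intro mult_pos_pos) auto
    then show ?thesis using False by (simp add: phi_right)
  qed (use left that in auto)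
  ultimately show ?thesis
    using yB knots_ordered by (auto simp: first_zero_def)
qed

text \<open>
  The point \<open>e\<close> is the vertex of the middle parabola or \<open>y\<^sub>i\<close>: somewhere on the descending branch the middle parabola
  is no longer positive, so its smaller root, which is (C), comes after \<open>y\<^sub>i'\<close> and not after \<open>e\<close>.
\<close>

lemma first_zero_cand_C:
  assumes z0: "0 < z0" and y': "0 < \<phi> i (y' i)"
    and e: "y' i \<le> e" "e \<le> x_hat i" "e \<le> y i" "\<phi> i e \<le> 0"
  shows "first_zero (cand_C i)"
proof -
  define D where "D = sqrt ((b i)\<^sup>2 - 2 * M * c i)"
  have e_le: "mid_parabola e \<le> 0" using e by (simp add: phi_mid)
  have "(b i)\<^sup>2 - 2 * M * c i = (M * e + b i)\<^sup>2 - 2 * M * mid_parabola e"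
    by (simp add: mid_parabola_def power2_eq_square field_simps)
  moreover have "2 * M * mid_parabola e \<le> 0"
    using M_pos e_le by (simp add: mult_le_0_iff)
  ultimately have disc: "0 \<le> (b i)\<^sup>2 - 2 * M * c i"
    by (smt (verit) zero_le_power2)
  have p: "cand_C i = (- b i - D) / M"
    by (simp add: cand_C_def D_def)
  have D: "0 \<le> D" using disc by (simp add: D_def)
  have Q: "mid_parabola x = M / 2 * ((cand_C i - x) * ((D - b i) / M - x))" for x
    unfolding mid_parabola_def p D_def
    using concave_quadratic_factor[of M "- b i" "- c i" "x"] M_pos disc
    by (simp add: algebra_simps)
  have hat: "x_hat i \<le> (D - b i) / M"
    using x_hat_eq M_pos D by (simp add: field_simps)
  have "cand_C i \<le> e"
  proof (rule ccontr)
    assume "\<not> ?thesis"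
    moreover have "(- b i - D) / M \<le> (D - b i) / M"
      using M_pos D by (intro divide_right_mono) auto
    ultimately have "0 < mid_parabola e"
      unfolding Q using M_pos p by (intro mult_pos_pos) auto
    then show False using e_le by simp
  qed
  have gt: "y' i < cand_C i"
  proof (rule ccontr)
    assume "\<not> ?thesis"
    then have "(cand_C i - y' i) * ((D - b i) / M - y' i) \<le> 0"
      using hat e by (intro mult_nonpos_nonneg) auto
    then have "mid_parabola (y' i) \<le> 0"
      unfolding Q using M_pos by (simp add: mult_le_0_iff)
    then show False using y' y'_less_y by (simp add: phi_mid)
  qed
  have "0 < \<phi> i x" if "x0 \<le> x" "x < cand_C i" for x
  proof (cases "x \<le> y' i")
    case True
    then show ?thesis using phi_left_ge[of x] that y' z0 by simp
  next
    case False
    have "0 < mid_parabola x"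
      unfolding Q using M_pos that hat \<open>cand_C i \<le> e\<close> e by (intro mult_pos_pos) auto
    then show ?thesis
      using False that \<open>cand_C i \<le> e\<close> e by (simp add: phi_mid)
  qed
  moreover have "\<phi> i (cand_C i) = 0"
    using gt \<open>cand_C i \<le> e\<close> e Q[of "cand_C i"] by (simp add: phi_mid)
  ultimately show ?thesis
    using gt \<open>cand_C i \<le> e\<close> e knots_ordered by (auto simp: first_zero_def)
qed

text \<open>
  The case distinctions of Step 5 locate the piece on which \<open>\<phi>\<^sub>i\<close> first stops being positive. In the two
  cases that lead to (B) the only point left for the nonpositive minimum is \<open>x\<^sub>i\<close>.
\<close>

lemma first_zero_step5_point:
  assumes h: "valid_h h" and i: "i \<in> {2..k}" and R: "R h i \<le> 0" and z0: "0 < z0"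
  shows "first_zero (step5_point i)"
proof (cases "\<phi> i (y' i) \<le> 0")
  case True
  then show ?thesis
    using first_zero_cand_A[OF z0] by (simp add: step5_point_def)
next
  case y': False
  show ?thesis
  proof (cases "in_I i")
    case True
    then have hat: "y' i < x_hat i" "x_hat i < y i" by (auto simp: in_I_iff)
    show ?thesis
    proof (cases "0 < \<phi> i (x_hat i)")
      case pos: True
      have "h i \<in> {x0, x_hat i, x1}"
        using h i True unfolding valid_h_def is_arg_min_def by metis
      then have "z1 \<le> 0"
        using R z0 pos by (auto simp: R_def phi_ends)
      moreover have "0 < \<phi> i x" if "x0 \<le> x" "x \<le> y i" for x
        using phi_left_ge[of x] phi_mid_ge(1)[of x] True pos y' z0 that
        by (cases "x \<le> y' i") auto
      ultimately show ?thesis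
        using first_zero_cand_B y' True pos by (simp add: step5_point_def)
    next
      case False
      then show ?thesis
        using first_zero_cand_C[OF z0, of "x_hat i"] y' True hat by (simp add: step5_point_def)
    qed
  next
    case False
    show ?thesis
    proof (cases "0 < \<phi> i (y i)")
      case pos: True
      have "h i \<in> {x0, x1}"
        using h i False unfolding valid_h_def is_arg_min_def by metis
      then have "z1 \<le> 0"
        using R z0 by (auto simp: R_def phi_ends)
      moreover have "0 < \<phi> i x" if "x0 \<le> x" "x \<le> y i" for x
        using phi_left_ge[of x] phi_mid_ge(2)[of x] False pos y' z0 that
        by (cases "x \<le> y' i") auto
      ultimately show ?thesis
        using first_zero_cand_B y' False pos by (simp add: step5_point_def)
    next
      case neg: False
      have "y i \<le> x_hat i"
      proof (rule ccontr)
        assume "\<not> ?thesis"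
        then have "x_hat i \<le> y' i" using False by (auto simp: in_I_iff)
        then have "(y' i - x_hat i)\<^sup>2 \<le> (y i - x_hat i)\<^sup>2"
          using y'_less_y by (intro power_mono) auto
        then have "\<phi> i (y' i) \<le> \<phi> i (y i)"
          using y'_less_y M_pos by (simp add: phi_mid mid_vertex[of "y i"] mid_vertex[of "y' i"])
        then show False using neg y' by simp
      qed
      then show ?thesis
        using first_zero_cand_C[OF z0, of "y i"] y' False neg y'_less_y by (simp add: step5_point_def)
    qed
  qed
qed

lemma step4_point_bounds: "x0 < step4_point h i" "step4_point h i < x1"
  using knots_ordered by (auto simp: step4_point_def in_I_iff)

text \<open>
  On the outer pieces this is Taylor's bound at an end point. On the middle piece consider the bound
  \<open>f t \<le> f x + f' x (t - x) + M (t - x)\<^sup>2 / 2\<close> from the point \<open>x\<close> itself: its quadratic part is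
  that of the middle parabola, so \<open>f t\<close> minus the parabola is at most an affine function of \<open>t\<close> whose
  value at \<open>x\<close> is the difference \<open>\<delta>\<close> in question. This affine function is nonnegative at both knots,
  where the parabola meets the outer ones, hence at \<open>x\<close>.
\<close>

lemma phi_le_f:
  assumes deriv: "\<And>x. x \<in> {x0..x1} \<Longrightarrow> (f has_real_derivative f' x) (at x within {x0..x1})"
    and lip: "M-lipschitz_on {x0..x1} f'"
    and x: "x \<in> {x0..x1}"
  shows "\<phi> i x \<le> f x"
proof -
  note taylor = lipschitz_deriv_taylor[OF deriv lip]
  have left: "left_parabola t \<le> f t" if "t \<in> {x0..x1}" for t
  proof -
    have "- (f t - (f x0 + f' x0 * (t - x0))) \<le> M / 2 * (t - x0)\<^sup>2"
      using that pt_less by (intro abs_le_D2 taylor) auto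
    then show ?thesis
      by (simp add: left_parabola_def z_def z'_def)
  qed
  have right: "right_parabola t \<le> f t" if "t \<in> {x0..x1}" for t
  proof -
    have "- (f t - (f x1 + f' x1 * (t - x1))) \<le> M / 2 * (t - x1)\<^sup>2"
      using that pt_less by (intro abs_le_D2 taylor) auto
    moreover have "f' x1 * (t - x1) = - (f' x1 * (x1 - t))" by (simp add: algebra_simps)
    ultimately show ?thesis
      by (simp add: right_parabola_def z_def z'_def power2_commute[of t x1])
  qed
  consider "x \<le> y' i" | "y' i < x" "x < y i" | "y i \<le> x" by linarith
  then show ?thesis
  proof cases
    case 1
    then show ?thesis using left x by (simp add: phi_left)
  next
    case 3
    then show ?thesis using right x by (simp add: phi_right)
  next
    case 2
    define \<delta> where "\<delta> = f x - mid_parabola x"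
    define \<kappa> where "\<kappa> = f' x - (M * x + b i)"
    have below: "f t - mid_parabola t \<le> \<delta> + \<kappa> * (t - x)" if "t \<in> {x0..x1}" for t
    proof -
      have "f t \<le> f x + f' x * (t - x) + M / 2 * (t - x)\<^sup>2"
        using abs_le_D1[OF taylor[OF _ x that]] by simp
      moreover have "mid_parabola t = mid_parabola x + (M * x + b i) * (t - x) + M / 2 * (t - x)\<^sup>2"
        by (simp add: mid_parabola_def power2_eq_square field_simps)
      ultimately show ?thesis
        by (simp add: \<delta>_def \<kappa>_def algebra_simps)
    qed
    have "0 \<le> \<delta> + \<kappa> * (y' i - x)"
      using below[of "y' i"] left[of "y' i"] mid_eq_left[of "y' i"] knots_ordered by simp
    moreover have "0 \<le> \<delta> + \<kappa> * (y i - x)"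
      using below[of "y i"] right[of "y i"] mid_eq_right[of "y i"] knots_ordered by simp
    moreover have "\<kappa> * (y' i - x) \<le> 0 \<or> \<kappa> * (y i - x) \<le> 0"
      using 2 by (cases "0 \<le> \<kappa>") (auto simp: mult_le_0_iff)
    ultimately have "0 \<le> \<delta>" by linarith
    then show ?thesis using 2 by (simp add: phi_mid \<delta>_def)
  qed
qed

text \<open>
  A zero of \<open>\<phi>\<^sub>i\<close> cannot be close to an end at which \<open>f\<close> is large: \<open>\<phi>\<^sub>i\<close> lies above the outer
  parabolas, and at distance \<open>s\<close> from its end an outer parabola has fallen by at most
  \<open>(B + M s / 2) s\<close>.
\<close>

lemma zero_far_from_ends:
  assumes p: "p \<in> {x0..x1}" "\<phi> i p \<le> 0"
    and B: "\<bar>g0\<bar> \<le> B" "\<bar>g1\<bar> \<le> B" and K: "B + M / 2 * (x1 - x0) \<le> K"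
  shows "z0 \<le> K * (p - x0)" "z1 \<le> K * (x1 - p)"
proof -
  have *: "\<beta> * s + M / 2 * s\<^sup>2 \<le> K * s" if s: "0 \<le> s" "s \<le> x1 - x0" and "\<beta> \<le> B" for s \<beta>
  proof -
    have "\<beta> + M / 2 * s \<le> B + M / 2 * (x1 - x0)"
      using that M_pos by (intro add_mono mult_left_mono) auto
    then have "(\<beta> + M / 2 * s) * s \<le> K * s"
      using K s by (intro mult_right_mono) auto
    then show ?thesis by (simp add: power2_eq_square algebra_simps)
  qed
  show "z0 \<le> K * (p - x0)"
    using *[of "p - x0" "- g0"] left_parabola_le_phi[of p] p B(1)[THEN abs_le_D2]
    by (simp add: left_parabola_def)
  show "z1 \<le> K * (x1 - p)"
    using *[of "x1 - p" g1] right_parabola_le_phi[of p] p B(2)[THEN abs_le_D1]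
    by (simp add: right_parabola_def)
qed

end

section \<open>One iteration of the search\<close>

lemma (in A2) v_nonneg: "0 \<le> v j"
  by (simp add: v_def d_def)

text \<open>
  In \<open>v\<^sub>j\<close> each of the trapezoidal error, which enters twice, and the increment of the derivative times
  the length is at most \<open>L\<close> times the squared length. A bound that does not depend on the interval keeps
  the estimates \<open>m\<^sub>i\<close> bounded.
\<close>

lemma (in A2) v_le_if_lipschitz:
  assumes less: "pt (j - 1) < pt j"
    and deriv: "\<And>x. x \<in> {pt (j - 1)..pt j} \<Longrightarrow>
      (f has_real_derivative f' x) (at x within {pt (j - 1)..pt j})"
    and lip: "L-lipschitz_on {pt (j - 1)..pt j} f'"
  shows "v j \<le> 3 * L"
proof -
  define A where "A = 2 * (z (j - 1) - z j) + (z' j + z' (j - 1)) * len j"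
  define G where "G = (z' j - z' (j - 1)) * len j"
  have len: "0 < len j" using less by (simp add: len_def)
  have "\<bar>z' j - z' (j - 1)\<bar> \<le> L * len j"
    using lipschitz_onD[OF lip, of "pt j" "pt (j - 1)"] less
    by (simp add: dist_real_def z'_def len_def)
  then have G: "\<bar>G\<bar> \<le> L * (len j)\<^sup>2"
    using len by (simp add: G_def abs_mult power2_eq_square mult_right_mono flip: mult.assoc)
  have "\<bar>z j - (z (j - 1) + z' (j - 1) * len j)\<bar> \<le> L / 2 * (len j)\<^sup>2"
    and "\<bar>z (j - 1) - (z j - z' j * len j)\<bar> \<le> L / 2 * (len j)\<^sup>2"
    using lipschitz_deriv_taylor[OF deriv lip, of "pt (j - 1)" "pt j"]
      lipschitz_deriv_taylor[OF deriv lip, of "pt j" "pt (j - 1)"] less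
    by (simp_all add: z_def z'_def len_def power2_commute algebra_simps)
  then have A: "\<bar>A\<bar> \<le> L * (len j)\<^sup>2"
    unfolding A_def abs_le_iff by (simp add: algebra_simps)
  have "d j = sqrt (A\<^sup>2 + G\<^sup>2)"
    by (simp add: d_def A_def G_def power_mult_distrib)
  also have "\<dots> \<le> \<bar>A\<bar> + \<bar>G\<bar>"
    by (rule sqrt_sum_squares_le_sum_abs)
  finally have "\<bar>A\<bar> + d j \<le> 3 * L * (len j)\<^sup>2"
    using A G by linarith
  then show ?thesis
    using len by (simp add: v_def A_def divide_le_eq)
qed

locale A2_state = A2 +
  fixes lo hi :: real
  assumes lo_less_hi: "lo < hi"
    and trials: "X ` {1..n} \<subseteq> {lo..hi}" "lo \<in> X ` {1..n}" "hi \<in> X ` {1..n}"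
    and f_lo: "0 < f lo"
    and xi_pos: "0 < \<xi>" and r_gt_1: "1 < r"
begin

lemma pt_strict_mono: "1 \<le> i \<Longrightarrow> i < j \<Longrightarrow> j \<le> N \<Longrightarrow> pt i < pt j"
  unfolding pt_def N_def
  using sorted_wrt_nth_less[OF strict_sorted_list_of_set, of "i - 1" "j - 1" "X ` {1..n}"]
  by simp

lemma pt_mono: "1 \<le> i \<Longrightarrow> i \<le> j \<Longrightarrow> j \<le> N \<Longrightarrow> pt i \<le> pt j"
  using pt_strict_mono[of i j] by (cases "i = j") auto

lemma pt_mem: "1 \<le> i \<Longrightarrow> i \<le> N \<Longrightarrow> pt i \<in> X ` {1..n}"
  unfolding pt_def N_def
  using nth_mem[of "i - 1" "sorted_list_of_set (X ` {1..n})"] by simp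

lemma trial_eq_pt:
  assumes "s \<in> X ` {1..n}"
  obtains i where "1 \<le> i" "i \<le> N" "s = pt i"
proof -
  have "s \<in> set (sorted_list_of_set (X ` {1..n}))" using assms by simp
  then obtain j where "j < N" "s = sorted_list_of_set (X ` {1..n}) ! j"
    unfolding in_set_conv_nth N_def by auto
  then show thesis by (intro that[of "Suc j"]) (auto simp: pt_def)
qed

lemma no_trial_between:
  assumes "2 \<le> i" "i \<le> N" "s \<in> X ` {1..n}"
  shows "s \<le> pt (i - 1) \<or> pt i \<le> s"
proof -
  obtain j where j: "1 \<le> j" "j \<le> N" "s = pt j" using trial_eq_pt[OF assms(3)] .
  show ?thesis
    using pt_mono[of j "i - 1"] pt_mono[of i j] j assms by (cases "j < i") auto
qed

lemma N_ge_2: "2 \<le> N"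
proof -
  have "card {lo, hi} \<le> N"
    unfolding N_def using trials by (intro card_mono) auto
  then show ?thesis using lo_less_hi by simp
qed

lemma pt_1: "pt 1 = lo"
proof -
  obtain j where j: "1 \<le> j" "j \<le> N" "lo = pt j" using trial_eq_pt[OF trials(2)] .
  then have "pt 1 \<le> lo" using pt_mono[of 1 j] by simp
  moreover have "pt 1 \<in> X ` {1..n}" using pt_mem N_ge_2 by simp
  ultimately show ?thesis using trials(1) by force
qed

lemma k_bounds: "2 \<le> k" "k \<le> N" and k_neg: "k < N \<Longrightarrow> f (pt k) < 0"
proof -
  have "k \<in> {N} \<union> {i. 1 < i \<and> i \<le> N \<and> f (pt i) < 0}"
    unfolding k_def by (intro Min_in) auto
  then show "2 \<le> k" "k \<le> N" "k < N \<Longrightarrow> f (pt k) < 0"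
    using N_ge_2 by auto
qed

lemma interval_len_pos: "i \<in> {2..k} \<Longrightarrow> pt (i - 1) < pt i"
  using k_bounds by (intro pt_strict_mono) auto

lemma interval: "i \<in> {2..k} \<Longrightarrow> A2_interval f f' \<xi> r X n i"
proof
  assume i: "i \<in> {2..k}"
  show "pt (i - 1) < pt i" by (rule interval_len_pos[OF i])
  have "v i \<le> lam i"
    unfolding lam_def using i by (intro Max_ge finite_imageI) auto
  then have "v i \<le> Max {lam i, gam i, \<xi>}" "\<xi> \<le> Max {lam i, gam i, \<xi>}"
    by (auto simp: max_def)
  moreover from this have "1 * Max {lam i, gam i, \<xi>} < m i"
    unfolding m_def using xi_pos r_gt_1 by (intro mult_strict_right_mono) auto
  ultimately show "v i < m i" by linarith
qed

lemma m_le: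
  assumes i: "i \<in> {2..k}" and v: "\<And>j. j \<in> {2..k} \<Longrightarrow> v j \<le> C"
  shows "m i \<le> r * max C \<xi>"
proof -
  have "lam i \<le> C"
    unfolding lam_def using i v by (intro Max.boundedI) (auto intro: exI[of _ i])
  moreover have "gam i \<le> C"
  proof -
    have ne: "{j. 1 < j \<and> j \<le> k} = {2..k}" by auto
    have "v i \<le> v_max" unfolding v_max_def ne using i by (intro Max_ge) auto
    then have v_max: "0 \<le> v_max" "v_max \<le> C"
      using v_nonneg[of i] v i unfolding v_max_def ne by (auto intro: order_trans Max.boundedI)
    have "len i \<le> X_max" unfolding X_max_def using i by (intro Max_ge) auto
    moreover have "0 < len i" using interval_len_pos[OF i] by (simp add: len_def)
    ultimately have "v_max * len i / X_max \<le> v_max"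
      using v_max by (simp add: divide_le_eq mult_left_mono)
    then show ?thesis using v_max by (simp add: gam_def)
  qed
  ultimately have "Max {lam i, gam i, \<xi>} \<le> max C \<xi>" by auto
  then show ?thesis
    unfolding m_def using r_gt_1 by (intro mult_left_mono) auto
qed

text \<open>
  At the selected interval all earlier characteristics are positive, and \<open>z\<^sub>i\<^sub>-\<^sub>1\<close> is a value of
  \<open>\<phi>\<^sub>i\<^sub>-\<^sub>1\<close>, hence at least \<open>R\<^sub>i\<^sub>-\<^sub>1\<close>; for the first interval it is \<open>f a\<close>.
\<close>

lemma left_value_pos:
  assumes h: "valid_h h" and i: "i \<in> {2..k}" and before: "\<And>j. j \<in> {2..<i} \<Longrightarrow> 0 < R h j"
  shows "0 < z (i - 1)"
proof (cases "i = 2")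
  case True
  then have "i - 1 = 1" by simp
  then show ?thesis using f_lo by (simp only: z_def pt_1)
next
  case False
  then have i': "i - 1 \<in> {2..k}" "i - 1 \<in> {2..<i}" using i by auto
  interpret left: A2_interval f f' \<xi> r X n "i - 1" by (rule interval[OF i'(1)])
  have "0 < R h (i - 1)" using before i' by blast
  also have "\<dots> \<le> z (i - 1)"
    using left.R_le_phi[OF h i'(1), of "pt (i - 1)"] left.pt_less left.phi_ends by simp
  finally show ?thesis .
qed

lemma selects_in_interval:
  assumes "selects i p"
  shows "i \<in> {2..k}" "pt (i - 1) < p" "p \<le> pt i"
proof -
  show i: "i \<in> {2..k}" using assms by (simp add: selects_def)
  interpret A2_interval f f' \<xi> r X n i by (rule interval[OF i])
  obtain h where h: "valid_h h" and
    "R h i \<le> 0 \<and> (\<forall>j\<in>{2..<i}. 0 < R h j) \<and> p = step5_point i \<or> p = step4_point h i"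
    using assms by (auto simp: selects_def)
  then have "pt (i - 1) < p \<and> p \<le> pt i"
  proof (elim disjE conjE)
    assume "R h i \<le> 0" "\<forall>j\<in>{2..<i}. 0 < R h j" "p = step5_point i"
    then show ?thesis
      using first_zero_step5_point[OF h i] left_value_pos[OF h i] by (simp add: first_zero_def)
  next
    assume "p = step4_point h i"
    then show ?thesis using step4_point_bounds[of h] by simp
  qed
  then show "pt (i - 1) < p" "p \<le> pt i" by auto
qed

text \<open>
  A nonpositive value of some \<open>\<phi>\<^sub>t\<close> forces \<open>R\<^sub>t \<le> 0\<close>. So the iteration passes through Step 5, and it
  stops scanning at \<open>t\<close> or earlier.
\<close>

lemma selects_first_zero:
  assumes sel: "selects i p" and t: "t \<in> {2..k}"
    and x: "x \<in> {pt (t - 1)..pt t}" "\<phi> t x \<le> 0"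
  shows "i \<le> t" "A2_interval.first_zero f f' \<xi> r X n i p"
proof -
  have i: "i \<in> {2..k}" using sel by (simp add: selects_def)
  interpret A2_interval f f' \<xi> r X n i by (rule interval[OF i])
  interpret t: A2_interval f f' \<xi> r X n t by (rule interval[OF t])
  obtain h where h: "valid_h h" and
    cases: "R h i \<le> 0 \<and> (\<forall>j\<in>{2..<i}. 0 < R h j) \<and> p = step5_point i \<or> (\<forall>j\<in>{2..k}. 0 < R h j)"
    using sel by (auto simp: selects_def)
  have Rt: "R h t \<le> 0" using t.R_le_phi[OF h t x(1)] x(2) by simp
  then have "\<not> (\<forall>j\<in>{2..k}. 0 < R h j)" using t by force
  with cases have 5: "R h i \<le> 0" "\<And>j. j \<in> {2..<i} \<Longrightarrow> 0 < R h j" "p = step5_point i"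
    by blast+
  show "i \<le> t"
    using 5(2)[of t] Rt t by force
  show "first_zero p"
    using first_zero_step5_point[OF h i 5(1)] left_value_pos[OF h i 5(2)] 5(3) by simp
qed

end

section \<open>Convergence to the least root\<close>

text \<open>
  The admissible constants form a nonempty closed set of nonnegative numbers, so there is a least one.
\<close>

lemma lipschitz_on_local_lipschitz_const:
  fixes g :: "real \<Rightarrow> real"
  assumes "L-lipschitz_on {u..w} g"
  shows "(local_lipschitz_const g u w)-lipschitz_on {u..w} g"
proof -
  define S where "S = {C. C-lipschitz_on {u..w} g}"
  have S_eq: "S = {0..} \<inter> (\<Inter>x\<in>{u..w}. \<Inter>y\<in>{u..w}. {C. dist (g x) (g y) \<le> C * dist x y})"
    by (auto simp: S_def lipschitz_on_def)
  have "closed S"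
    unfolding S_eq by (intro closed_Int closed_INT ballI closed_Collect_le closed_atLeast) (auto intro!: continuous_intros)
  moreover have "S \<noteq> {}" "bdd_below S"
    using assms by (auto simp: S_def lipschitz_on_def intro!: bdd_belowI[of _ 0])
  ultimately have "Inf S \<in> S" and "\<And>C. C \<in> S \<Longrightarrow> Inf S \<le> C"
    by (auto intro: closed_contains_Inf cInf_lower)
  then have "local_lipschitz_const g u w = Inf S"
    unfolding local_lipschitz_const_def by (intro Least_equality) (auto simp: S_def)
  with \<open>Inf S \<in> S\<close> show ?thesis by (simp add: S_def)
qed

lemma least_root:
  fixes f :: "real \<Rightarrow> real"
  assumes cont: "continuous_on {a..b} f" and f_a: "0 < f a" and root: "\<exists>x\<in>{a..b}. f x = 0"
    and xstar: "xstar = (LEAST x. x \<in> {a..b} \<and> f x = 0)"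
  shows "xstar \<in> {a..b}" "f xstar = 0" "\<And>x. x \<in> {a..<xstar} \<Longrightarrow> 0 < f x"
proof -
  define Z where "Z = {x \<in> {a..b}. f x = 0}"
  have "compact Z"
  proof -
    have "closed Z"
      unfolding Z_def using continuous_closed_preimage_constant[OF cont, of 0] by simp
    moreover have "bounded Z"
      by (rule bounded_subset[OF bounded_closed_interval[of a b]]) (auto simp: Z_def)
    ultimately show ?thesis by (simp add: compact_eq_bounded_closed)
  qed
  moreover have "Z \<noteq> {}" using root by (auto simp: Z_def)
  ultimately obtain s where s: "s \<in> Z" "\<And>x. x \<in> Z \<Longrightarrow> s \<le> x"
    by (meson compact_attains_inf)
  then have "xstar = s"
    unfolding xstar by (intro Least_equality) (auto simp: Z_def)
  with s show X: "xstar \<in> {a..b}" "f xstar = 0" by (auto simp: Z_def)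
  show "0 < f x" if x: "x \<in> {a..<xstar}" for x
  proof (rule ccontr)
    assume "\<not> 0 < f x"
    then obtain y where "a \<le> y" "y \<le> x" "f y = 0"
      using IVT2'[of f x 0 a] f_a x X cont by (force intro: continuous_on_subset)
    then have "y \<in> Z" "y < xstar" using x X by (auto simp: Z_def)
    then show False using s \<open>xstar = s\<close> by force
  qed
qed

text \<open>
  The invariant persists because a new trial lies in the selected interval, whichever step proposes it.
\<close>

lemma A2_state_of_sequence:
  assumes seq: "A2_sequence a b f f' \<xi> r \<sigma> n0 X"
    and "a < b" "0 < f a" "0 < \<xi>" "1 < r" and n: "n0 \<le> n"
  shows "A2_state f \<xi> r X n a b"
  using n
proof (induction n rule: dec_induct)
  case base
  then show ?case using assms by unfold_locales (auto simp: A2_sequence_def)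
next
  case (step n)
  interpret A2_state f f' \<xi> r X n a b by (rule step.IH)
  obtain i where sel: "selects i (X (Suc n))"
    using seq step.hyps by (auto simp: A2_sequence_def)
  note i = selects_in_interval[OF this]
  have "pt (i - 1) \<in> X ` {1..n}" "pt i \<in> X ` {1..n}"
    using i(1) k_bounds by (auto intro!: pt_mem)
  then have "pt (i - 1) \<in> {a..b}" "pt i \<in> {a..b}"
    using trials(1) by blast+
  then have "X (Suc n) \<in> {a..b}"
    using i by auto
  moreover have "{1..Suc n} = insert (Suc n) {1..n}" by auto
  ultimately show ?case
    using trials lo_less_hi f_lo xi_pos r_gt_1 by unfold_locales auto
qed

theorem theorem3:
  fixes a b L \<xi> r xstar :: real
    and f f' :: "real \<Rightarrow> real"
    and X :: "nat \<Rightarrow> real"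
    and n0 :: nat
    and t :: "nat \<Rightarrow> nat"
  assumes "a < b"
    and "\<And>x. x \<in> {a..b} \<Longrightarrow> (f has_real_derivative f' x) (at x within {a..b})"
    and "f a > 0"
    and "0 < L"
    and "\<And>x y. x \<in> {a..b} \<Longrightarrow> y \<in> {a..b} \<Longrightarrow> \<bar>f' x - f' y\<bar> \<le> L * \<bar>x - y\<bar>"
    and "\<exists>x\<in>{a..b}. f x = 0"
    and "xstar = (LEAST x. x \<in> {a..b} \<and> f x = 0)"
    and "\<xi> > 0"
    and "r > 1"
    and "A2_sequence a b f f' \<xi> r 0 n0 X"
    and "\<And>n. n \<ge> n0 \<Longrightarrow> 1 < t n \<and> t n \<le> A2.N X n \<and> xstar \<in> {A2.pt X n (t n - 1)..A2.pt X n (t n)}"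
    and "\<exists>nstar. \<forall>n>nstar. n \<ge> n0 \<longrightarrow>
           A2.m f f' \<xi> r X n (t n) \<ge> local_lipschitz_const f' (A2.pt X n (t n - 1)) (A2.pt X n (t n))"
  shows "seq_limit_points X = {xstar}"
proof -
  note deriv = assms(2) and seq = assms(10) and t = assms(11)
  have lip: "L-lipschitz_on {a..b} f'"
    using assms(4,5) by (auto intro!: lipschitz_onI simp: dist_real_def)
  have cont: "continuous_on {a..b} f"
    using deriv by (intro DERIV_continuous_on)
  note root = least_root[OF cont assms(3,6,7)]
  note state = A2_state_of_sequence[OF seq assms(1,3,8,9)]
  obtain nstar where nstar: "\<And>n. nstar < n \<Longrightarrow> n0 \<le> n \<Longrightarrow>
      local_lipschitz_const f' (A2.pt X n (t n - 1)) (A2.pt X n (t n)) \<le> A2.m f f' \<xi> r X n (t n)"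
    using assms(12) by blast
  define n1 where "n1 = max (Suc nstar) n0"
  define B where "B = \<bar>f' a\<bar> + L * (b - a)"
  \<comment> \<open>bounds the descent rate of the outer parabolas on every interval, since \<open>v\<^sub>j \<le> 3 L\<close>\<close>
  define K where "K = B + r * max (3 * L) \<xi> / 2 * (b - a)"
  have B: "\<bar>f' x\<bar> \<le> B" if "x \<in> {a..b}" for x
  proof -
    have "\<bar>f' x - f' a\<bar> \<le> L * (x - a)" using assms(5)[of x a] that by auto
    also have "\<dots> \<le> L * (b - a)" using that assms(4) by (intro mult_left_mono) auto
    finally show ?thesis by (simp add: B_def)
  qed
  have "0 < B" using assms(1,4) by (simp add: B_def add_nonneg_pos)
  moreover have "0 < r * max (3 * L) \<xi> / 2 * (b - a)"
    using assms(1,4,8,9) by (intro mult_pos_pos divide_pos_pos) auto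
  ultimately have "0 < K" by (simp add: K_def)

  have X_in: "X n \<in> {a..b}" if "1 \<le> n" for n
  proof -
    interpret A2_state f f' \<xi> r X "max n n0" a b by (rule state) simp
    have "X n \<in> X ` {1..max n n0}" using that by auto
    then show ?thesis using trials(1) by blast
  qed

  \<comment> \<open>\<open>u\<close> and \<open>w\<close> are the neighbours \<open>x\<^sub>i\<^sub>-\<^sub>1\<close> and \<open>x\<^sub>i\<close> of the new trial\<close>
  have step: "\<exists>u w. u < X (Suc n) \<and> X (Suc n) \<le> w \<and> X (Suc n) \<le> xstar \<and>
      f u \<le> K * (X (Suc n) - u) \<and> f w \<le> K * (w - X (Suc n)) \<and> u \<in> {a..b} \<and> w \<in> {a..b} \<and>
      (\<forall>j\<in>{1..n}. X j \<le> u \<or> w \<le> X j)" if n: "n1 \<le> n" for n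
  proof -
    have n': "nstar < n" "n0 \<le> n" using n by (auto simp: n1_def)
    interpret A2_state f f' \<xi> r X n a b by (rule state[OF n'(2)])
    obtain i where sel: "selects i (X (Suc n))"
      using seq n' by (auto simp: A2_sequence_def)
    note i = selects_in_interval[OF this]
    note tn = t[OF n'(2)]
    have pt_in: "pt j \<in> {a..b}" if "1 \<le> j" "j \<le> N" for j
      using pt_mem[OF that] trials(1) by blast
    have sub: "{pt (j - 1)..pt j} \<subseteq> {a..b}" if "j \<in> {2..k}" for j
      using pt_in[of "j - 1"] pt_in[of j] that k_bounds by auto
    have deriv': "(f has_real_derivative f' x) (at x within {pt (j - 1)..pt j})"
      if "j \<in> {2..k}" "x \<in> {pt (j - 1)..pt j}" for j x
      using DERIV_subset[OF deriv sub] sub that by blast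
    have lip': "L-lipschitz_on {pt (j - 1)..pt j} f'" if "j \<in> {2..k}" for j
      by (rule lipschitz_on_subset[OF lip sub[OF that]])

    \<comment> \<open>\<open>f\<close> is negative at \<open>x\<^sub>k\<close> unless \<open>x\<^sub>k = b\<close>, so the least root comes before \<open>x\<^sub>k\<close>\<close>
    have "t n \<le> k"
    proof (rule ccontr)
      assume "\<not> t n \<le> k"
      then have k: "k < N" "k \<le> t n - 1" using tn by auto
      have "pt k \<le> pt (t n - 1)"
        using k tn k_bounds by (intro pt_mono) linarith+
      then have "pt k \<le> xstar" using tn by auto
      moreover have "a \<le> pt k" using pt_in[of k] k k_bounds by auto
      ultimately have "0 \<le> f (pt k)"
        using root(2) root(3)[of "pt k"] by (cases "pt k = xstar") auto
      then show False using k_neg k by simp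
    qed
    then have tk: "t n \<in> {2..k}" using tn by auto
    interpret t: A2_interval f f' \<xi> r X n "t n" by (rule interval[OF tk])
    have "(m (t n))-lipschitz_on {pt (t n - 1)..pt (t n)} f'"
      using lipschitz_on_mono[OF lipschitz_on_local_lipschitz_const[OF lip'[OF tk]] order_refl nstar[OF n']] .
    then have phi_t: "\<phi> (t n) x \<le> f x" if "x \<in> {pt (t n - 1)..pt (t n)}" for x
      using t.phi_le_f[OF deriv'[OF tk]] that by blast
    then have xs: "\<phi> (t n) xstar \<le> 0" using tn root(2) by force
    interpret A2_interval f f' \<xi> r X n i by (rule interval[OF i(1)])
    have "i \<le> t n" and fz: "first_zero (X (Suc n))"
      using selects_first_zero[OF sel tk _ xs] tn by auto
    have "X (Suc n) \<le> xstar"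
    proof (cases "i = t n")
      case True
      then have "\<not> 0 < \<phi> i xstar" "pt (i - 1) \<le> xstar"
        using xs tn by auto
      then show ?thesis
        using fz unfolding first_zero_def by (meson not_le)
    next
      case False
      then have "pt i \<le> pt (t n - 1)"
        using \<open>i \<le> t n\<close> i(1) tn by (intro pt_mono) auto
      then show ?thesis using i tn by auto
    qed
    moreover have "m i \<le> r * max (3 * L) \<xi>"
      using v_le_if_lipschitz[OF interval_len_pos deriv' lip'] by (intro m_le i) auto
    then have "B + m i / 2 * (pt i - pt (i - 1)) \<le> K"
      using sub[OF i(1)] pt_less M_pos assms(4,8,9)
      unfolding K_def by (intro add_left_mono mult_mono) auto
    then have "f (pt (i - 1)) \<le> K * (X (Suc n) - pt (i - 1))" "f (pt i) \<le> K * (pt i - X (Suc n))"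
      using zero_far_from_ends[of "X (Suc n)" B K] fz B[of "pt i"] B[of "pt (i - 1)"]
        sub[OF i(1)] pt_less
      by (auto simp: first_zero_def z_def z'_def)
    moreover have "\<forall>j\<in>{1..n}. X j \<le> pt (i - 1) \<or> pt i \<le> X j"
      using no_trial_between[of i] i(1) k_bounds by auto
    ultimately show ?thesis
      using i sub[OF i(1)] pt_less
      by (intro exI[of _ "pt (i - 1)"] exI[of _ "pt i"]) auto
  qed

  have le_xstar: "X n \<le> xstar" if "n1 < n" for n
    using step[of "n - 1"] that by (cases n) auto

  have separated: "\<exists>c>0. \<forall>n\<ge>n1. \<forall>j\<in>{1..n}. X (Suc n) \<le> w \<longrightarrow> c \<le> \<bar>X j - X (Suc n)\<bar>"
    if "w < xstar" for w
  proof (cases "a \<le> w")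
    case False
    then have "\<not> X (Suc n) \<le> w" for n using X_in[of "Suc n"] by auto
    then show ?thesis by (intro exI[of _ 1]) simp
  next
    case True
    \<comment> \<open>a right neighbour beyond \<open>w'\<close>, where \<open>f\<close> may be small, is at least \<open>w' - w\<close> away anyway\<close>
    define w' where "w' = (w + xstar) / 2"
    have w': "w < w'" "w' < xstar" "a \<le> w'" using that True by (auto simp: w'_def)
    have "continuous_on {a..w'} f"
      using cont by (rule continuous_on_subset) (use w' root(1) in auto)
    then obtain x where x: "x \<in> {a..w'}" "\<And>u. u \<in> {a..w'} \<Longrightarrow> f x \<le> f u"
      using continuous_attains_inf[of "{a..w'}" f] w' by auto
    have fx: "0 < f x" using root(3)[of x] x(1) w' by auto
    define c where "c = min (f x / K) (w' - w)"
    have "0 < c" using fx \<open>0 < K\<close> w' by (simp add: c_def)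
    moreover have "c \<le> \<bar>X j - X (Suc n)\<bar>"
      if n: "n1 \<le> n" and j: "j \<in> {1..n}" and le: "X (Suc n) \<le> w" for n j
    proof -
      obtain u v where uv: "u < X (Suc n)" "X (Suc n) \<le> v" "f u \<le> K * (X (Suc n) - u)"
        "f v \<le> K * (v - X (Suc n))" "u \<in> {a..b}" "v \<in> {a..b}" "X j \<le> u \<or> v \<le> X j"
        using step[OF n] j by blast
      have "f x / K \<le> X (Suc n) - u"
        using x(2)[of u] uv le w' \<open>0 < K\<close> by (simp add: divide_le_eq mult.commute)
      moreover have "f x / K \<le> v - X (Suc n) \<or> w' - w \<le> v - X (Suc n)"
        using x(2)[of v] uv le w' \<open>0 < K\<close>
        by (cases "v \<le> w'") (auto simp: divide_le_eq mult.commute)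
      ultimately show ?thesis
        using uv by (auto simp: c_def)
    qed
    ultimately show ?thesis by blast
  qed

  have limit_eq: "l = xstar" if s: "strict_mono s" and lim: "(X \<circ> s) \<longlonglongrightarrow> l" for s :: "nat \<Rightarrow> nat" and l
  proof -
    have s_ge: "j \<le> s j" for j using s by (rule strict_mono_imp_increasing)
    have "(X \<circ> s) j \<le> xstar" if "Suc n1 \<le> j" for j
      using le_xstar[of "s j"] s_ge[of j] that by simp
    then have "eventually (\<lambda>j. (X \<circ> s) j \<le> xstar) sequentially"
      by (rule eventually_sequentiallyI)
    from tendsto_upperbound[OF lim this sequentially_bot] have "l \<le> xstar" .
    moreover have "\<not> l < xstar"
    proof
      assume "l < xstar"
      define w where "w = (l + xstar) / 2"
      have w: "l < w" "w < xstar" using \<open>l < xstar\<close> by (auto simp: w_def)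
      obtain c where c: "0 < c" "\<And>n j. n1 \<le> n \<Longrightarrow> j \<in> {1..n} \<Longrightarrow> X (Suc n) \<le> w \<Longrightarrow> c \<le> \<bar>X j - X (Suc n)\<bar>"
        using separated[OF w(2)] by blast
      obtain J1 where J1: "\<And>j. J1 \<le> j \<Longrightarrow> X (s j) < w"
        using order_tendstoD(2)[OF lim w(1)] by (auto simp: eventually_sequentially)
      obtain J2 where J2: "\<And>i j. J2 \<le> i \<Longrightarrow> J2 \<le> j \<Longrightarrow> \<bar>X (s i) - X (s j)\<bar> < c"
        using LIMSEQ_imp_Cauchy[OF lim] c(1) unfolding Cauchy_def dist_real_def by force
      define j where "j = Suc (max n1 (max J1 J2))"
      have J: "J1 \<le> Suc j" "J2 \<le> j" "J2 \<le> Suc j" unfolding j_def by linarith+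
      have less: "s j < s (Suc j)" using s by (simp add: strict_mono_Suc_iff)
      have "n1 < s j" using s_ge[of j] unfolding j_def by linarith
      obtain n where n: "s (Suc j) = Suc n" "s j \<le> n"
        using less by (cases "s (Suc j)") auto
      have "X (Suc n) \<le> w"
        using J1[OF J(1)] unfolding n(1)[symmetric] by simp
      with \<open>n1 < s j\<close> n(2) have "c \<le> \<bar>X (s j) - X (s (Suc j))\<bar>"
        unfolding n(1) by (intro c(2)) auto
      moreover have "\<bar>X (s j) - X (s (Suc j))\<bar> < c"
        by (rule J2[OF J(2,3)])
      ultimately show False by simp
    qed
    ultimately show ?thesis by simp
  qed

  have "\<exists>l s. strict_mono (s :: nat \<Rightarrow> nat) \<and> (X \<circ> s) \<longlonglongrightarrow> l"
  proof -
    have "\<forall>n. (X \<circ> Suc) n \<in> {a..b}" using X_in by simp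
    then obtain l s where "strict_mono s" "(X \<circ> Suc \<circ> s) \<longlonglongrightarrow> l"
      using compact_Icc[of a b] unfolding compact_def by metis
    then have "strict_mono (Suc \<circ> s)" "(X \<circ> (Suc \<circ> s)) \<longlonglongrightarrow> l"
      by (auto simp: strict_mono_def comp_assoc)
    then show ?thesis by blast
  qed
  then show ?thesis
    using limit_eq unfolding seq_limit_points_def by blast
qed

end
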